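(* Let $M_t\ge 1$ and $1\le N\le K$ be integers, $\rho>0$, let $B_R$ be a nonnegative integer, and let $b_1,\dots,b_N$ be nonnegative integers with $\sum_{j=1}^N b_j=B_Q$. For $m=1,\dots,M_t$ and $k=1,\dots,K$ let $X_{m,k}$ be an exponential random variable with mean $\rho$ (the SNR of user $k$ on beam $m$). Let $r_{th,0}=\infty$ and $r_{th,j}=\rho\ln(K/j)$ for $j=1,\dots,N$. Suppose that, for each beam $m$, user $k$ feeds back $B_R+b_j$ bits if $X_{m,k}\in[r_{th,j},r_{th,j-1})$ for some $j\in\{1,\dots,N\}$, and feeds back $0$ bits if $X_{m,k}<r_{th,N}$. Then the expected total number of feedback bits over all users and all beams is $$\overline{F}_b=M_t\,(N B_R+B_Q),$$ which does not depend on the number of users $K$.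
   Context: This is the multi-threshold feedback scheme: $B_R=\lceil\log_2 N\rceil$ is the number of bits used to indicate the region (inferred rank) in which the SNR falls, and $b_j$ is the number of additional bits used to quantize the SNR within region $j$. *)

theory Defs
  imports "HOL-Probability.Probability"
begin

definition r_th :: "real \<Rightarrow> nat \<Rightarrow> nat \<Rightarrow> ereal" where
  "r_th \<rho> K j = (if j = 0 then \<infinity> else ereal (\<rho> * ln (real K / real j)))"

(* exponential_density takes the rate, i.e. the reciprocal of the mean *)
definition exponential_with_mean :: "'a measure \<Rightarrow> real \<Rightarrow> ('a \<Rightarrow> real) \<Rightarrow> bool" where
  "exponential_with_mean M \<rho> Y \<longleftrightarrow> distributed M lborel Y (exponential_density (1 / \<rho>))"

end

theory Submission
  imports Defs
begin

text \<open>The thresholds make the regions equally likely: since \<open>P(Y \<ge> r_th j) = j / K\<close>, each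
  region has probability \<open>1 / K\<close>, so one user on one beam contributes
  \<open>\<Sum>j. (B_R + b j) / K\<close> bits on average, and the sum over the \<open>K\<close> users cancels the \<open>1 / K\<close>.\<close>

text \<open>The regions are closed at their lower end, so the tail is needed with a non-strict
  inequality. It agrees with the strict tail because the law has a density and therefore gives the
  single point \<open>a\<close> mass zero.\<close>

lemma (in prob_space) exponential_distributedD_ge:
  fixes Y :: "'a \<Rightarrow> real"
  assumes D: "distributed M lborel Y (exponential_density l)" and "0 \<le> a" and "0 < l"
  shows "\<P>(x in M. a \<le> Y x) = exp (- a * l)"
proof -
  have [measurable]: "Y \<in> borel_measurable M"
    using distributed_measurable[OF D] by simp
  have "AE x in M. Y x \<noteq> a"
    using AE_lborel_singleton[of a] by (subst distributed_AE2[OF D]) auto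
  then have "\<P>(x in M. a \<le> Y x) = \<P>(x in M. a < Y x)"
    by (intro finite_measure_eq_AE) auto
  with exponential_distributedD_gt[OF D \<open>0 \<le> a\<close> \<open>0 < l\<close>] show ?thesis by simp
qed

lemma r_th_antimono:
  assumes "\<rho> > 0" "1 \<le> K" "i \<le> j"
  shows "r_th \<rho> K j \<le> r_th \<rho> K i"
  using assms by (auto simp: r_th_def intro!: divide_left_mono)

text \<open>The thresholds are quantiles: \<open>\<rho> * ln (K / j)\<close> inverts the exponential
  tail. The value \<infinity> at \<open>j = 0\<close> fits the same formula, since no real reaches
  it and the tail is 0.\<close>

lemma (in prob_space) prob_ge_r_th:
  fixes Y :: "'a \<Rightarrow> real"
  assumes "exponential_with_mean M \<rho> Y" "\<rho> > 0" "1 \<le> K" "j \<le> K"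
  shows "\<P>(x in M. r_th \<rho> K j \<le> ereal (Y x)) = real j / real K"
proof (cases "j = 0")
  case True
  then show ?thesis by (simp add: r_th_def)
next
  case False
  \<comment> \<open>The tail formula requires a nonnegative threshold; \<open>j \<le> K\<close>
    ensures this, as then \<open>K / j\<close> is at least 1.\<close>
  have "\<P>(x in M. \<rho> * ln (K / j) \<le> Y x) = exp (- (\<rho> * ln (K / j)) * (1 / \<rho>))"
    using assms False
    by (intro exponential_distributedD_ge) (auto simp: exponential_with_mean_def)
  also have "\<dots> = exp (- ln (K / j))" using assms by simp
  also have "\<dots> = real j / real K" using assms False by (simp add: exp_minus)
  finally show ?thesis using False by (simp add: r_th_def)
qed

lemma (in prob_space) prob_region:
  fixes Y :: "'a \<Rightarrow> real"
  assumes exp: "exponential_with_mean M \<rho> Y" and "\<rho> > 0" "1 \<le> j" "j \<le> K"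
  shows "\<P>(x in M. ereal (Y x) \<in> {r_th \<rho> K j..<r_th \<rho> K (j - 1)}) = 1 / real K"
proof -
  have [measurable]: "Y \<in> borel_measurable M"
    using exp by (auto simp: exponential_with_mean_def dest: distributed_measurable)
  let ?A = "\<lambda>j. {x \<in> space M. r_th \<rho> K j \<le> ereal (Y x)}"
  \<comment> \<open>A region is the difference of two nested tail events, so its probability is j/K
    - (j-1)/K.\<close>
  have "{x \<in> space M. ereal (Y x) \<in> {r_th \<rho> K j..<r_th \<rho> K (j - 1)}} = ?A j - ?A (j - 1)"
    by auto
  moreover have "?A (j - 1) \<subseteq> ?A j"
    using r_th_antimono[of \<rho> K "j - 1" j] assms by (auto intro: order_trans)
  ultimately have "\<P>(x in M. ereal (Y x) \<in> {r_th \<rho> K j..<r_th \<rho> K (j - 1)})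
      = prob (?A j) - prob (?A (j - 1))"
    by (simp add: finite_measure_Diff)
  then show ?thesis
    using assms by (simp add: prob_ge_r_th diff_divide_distrib[symmetric] of_nat_diff)
qed

lemma region_unique:
  assumes "\<rho> > 0" "1 \<le> K" "y \<in> {r_th \<rho> K i..<r_th \<rho> K (i - 1)}"
    and "y \<in> {r_th \<rho> K j..<r_th \<rho> K (j - 1)}"
  shows "i = j"
proof -
  have False if "i < j" "y \<in> {r_th \<rho> K i..<r_th \<rho> K (i - 1)}"
    "y \<in> {r_th \<rho> K j..<r_th \<rho> K (j - 1)}" for i j
  proof -
    \<comment> \<open>Since i \<le> j - 1, the excluded upper end of region \<open>j\<close> does
      not exceed the included lower end of region \<open>i\<close>.\<close>
    have "r_th \<rho> K (j - 1) \<le> r_th \<rho> K i"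
      using that(1) by (intro r_th_antimono assms(1,2)) simp
    with that(2,3) show False by (auto dest: order.strict_trans2)
  qed
  then show ?thesis using assms(3,4) by (meson linorder_neqE_nat)
qed

lemma region_exists:
  assumes "r_th \<rho> K N \<le> ereal y"
  shows "\<exists>j\<in>{1..N}. ereal y \<in> {r_th \<rho> K j..<r_th \<rho> K (j - 1)}"
  using assms
proof (induction N)
  \<comment> \<open>Vacuous: the threshold of index 0 is \<infinity>, which no real value
    reaches.\<close>
  case 0
  then show ?case by (simp add: r_th_def)
next
  case (Suc N)
  show ?case
  proof (cases "r_th \<rho> K N \<le> ereal y")
    case True
    with Suc.IH obtain j where "j \<in> {1..N}" "ereal y \<in> {r_th \<rho> K j..<r_th \<rho> K (j - 1)}"
      by blast
    then show ?thesis by (intro bexI[of _ j]) auto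
  next
    case False
    then show ?thesis using Suc.prems by (intro bexI[of _ "Suc N"]) auto
  qed
qed

text \<open>On \<open>space M\<close>, \<open>g\<close> agrees with a finite combination of
  indicators of the regions. This yields measurability, integrability and the value of the integral
  together, so \<open>g\<close> need only be described region by region.\<close>

lemma (in prob_space) has_bochner_integral_region_feedback:
  fixes Y :: "'a \<Rightarrow> real" and g :: "'a \<Rightarrow> real" and c :: "nat \<Rightarrow> real"
  assumes exp: "exponential_with_mean M \<rho> Y" and "\<rho> > 0" "1 \<le> K" "N \<le> K"
    and region: "\<And>j x. j \<in> {1..N} \<Longrightarrow> x \<in> space M \<Longrightarrow>
      ereal (Y x) \<in> {r_th \<rho> K j..<r_th \<rho> K (j - 1)} \<Longrightarrow> g x = c j"
    and below: "\<And>x. x \<in> space M \<Longrightarrow> ereal (Y x) < r_th \<rho> K N \<Longrightarrow> g x = 0"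
  shows "has_bochner_integral M g ((\<Sum>j=1..N. c j) / real K)"
proof -
  have [measurable]: "Y \<in> borel_measurable M"
    using exp by (auto simp: exponential_with_mean_def dest: distributed_measurable)
  let ?D = "\<lambda>j. {x \<in> space M. ereal (Y x) \<in> {r_th \<rho> K j..<r_th \<rho> K (j - 1)}}"
  have g_eq: "g x = (\<Sum>j=1..N. c j * indicator (?D j) x)" if x: "x \<in> space M" for x
  proof (cases "ereal (Y x) < r_th \<rho> K N")
    case True
    \<comment> \<open>For \<open>j \<le> N\<close> the lower end of region \<open>j\<close> is at
      least \<open>r_th \<rho> K N\<close>, which lies above \<open>Y x\<close>.\<close>
    have "x \<notin> ?D j" if "j \<in> {1..N}" for j
      using r_th_antimono[of \<rho> K j N] that True assms(2,3) by auto
    then have "(\<Sum>j=1..N. c j * indicator (?D j) x) = 0"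
      by (intro sum.neutral) (metis indicator_simps(2) mult_zero_right)
    then show ?thesis using below[OF x True] by simp
  next
    case False
    then obtain i where i: "i \<in> {1..N}" "ereal (Y x) \<in> {r_th \<rho> K i..<r_th \<rho> K (i - 1)}"
      using region_exists[of \<rho> K N "Y x"] by (auto simp: not_less)
    \<comment> \<open>Disjointness of the regions leaves a single nonzero term in the sum.\<close>
    have "x \<in> ?D j \<longleftrightarrow> j = i" for j
      using region_unique[OF assms(2,3) i(2), of j] i x by blast
    then have "(\<Sum>j=1..N. c j * indicator (?D j) x) = (\<Sum>j=1..N. if j = i then c j else 0)"
      by (intro sum.cong) (simp_all only: indicator_def, simp_all)
    also have "\<dots> = c i" using i(1) by simp
    finally show ?thesis using region[OF i(1) x i(2)] by simp
  qed
  have "has_bochner_integral M (\<lambda>x. \<Sum>j=1..N. c j * indicator (?D j) x) (\<Sum>j=1..N. c j * prob (?D j))"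
    by (intro has_bochner_integral_sum has_bochner_integral_mult_right
        has_bochner_integral_real_indicator) (auto simp: emeasure_eq_measure)
  moreover have "(\<Sum>j=1..N. c j * prob (?D j)) = (\<Sum>j=1..N. c j) / real K"
    unfolding sum_divide_distrib
    by (intro sum.cong refl, subst prob_region[OF exp]) (use assms in auto)
  ultimately show ?thesis
    using g_eq by (simp cong: has_bochner_integral_cong)
qed

theorem mainTheorem3:
  fixes M :: "'a measure"
    and M\<^sub>t N K B\<^sub>R B\<^sub>Q :: nat
    and b :: "nat \<Rightarrow> nat"
    and \<rho> :: real
    and X :: "nat \<Rightarrow> nat \<Rightarrow> 'a \<Rightarrow> real"
    and bits :: "nat \<Rightarrow> nat \<Rightarrow> 'a \<Rightarrow> nat"
  assumes "prob_space M"
    and "1 \<le> M\<^sub>t" and "1 \<le> N" and "N \<le> K" and "\<rho> > 0"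
    and "(\<Sum>j=1..N. b j) = B\<^sub>Q"
    and "\<And>m k. m \<in> {1..M\<^sub>t} \<Longrightarrow> k \<in> {1..K} \<Longrightarrow> exponential_with_mean M \<rho> (X m k)"
    and "\<And>m k j \<omega>. m \<in> {1..M\<^sub>t} \<Longrightarrow> k \<in> {1..K} \<Longrightarrow> j \<in> {1..N} \<Longrightarrow> \<omega> \<in> space M \<Longrightarrow>
           ereal (X m k \<omega>) \<in> {r_th \<rho> K j..<r_th \<rho> K (j - 1)} \<Longrightarrow> bits m k \<omega> = B\<^sub>R + b j"
    and "\<And>m k \<omega>. m \<in> {1..M\<^sub>t} \<Longrightarrow> k \<in> {1..K} \<Longrightarrow> \<omega> \<in> space M \<Longrightarrow>
           ereal (X m k \<omega>) < r_th \<rho> K N \<Longrightarrow> bits m k \<omega> = 0"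
  shows "prob_space.expectation M (\<lambda>\<omega>. \<Sum>m=1..M\<^sub>t. \<Sum>k=1..K. real (bits m k \<omega>))
           = real (M\<^sub>t * (N * B\<^sub>R + B\<^sub>Q))"
proof -
  interpret prob_space M by fact
  have "has_bochner_integral M (\<lambda>\<omega>. real (bits m k \<omega>))
      ((\<Sum>j=1..N. real (B\<^sub>R + b j)) / real K)" if "m \<in> {1..M\<^sub>t}" "k \<in> {1..K}" for m k
    using assms that by (intro has_bochner_integral_region_feedback[of \<rho> "X m k"]) auto
  \<comment> \<open>Linearity alone combines users and beams, whatever the joint law of the
    \<open>X m k\<close>.\<close>
  then have "has_bochner_integral M (\<lambda>\<omega>. \<Sum>m=1..M\<^sub>t. \<Sum>k=1..K. real (bits m k \<omega>))
      (\<Sum>m=1..M\<^sub>t. \<Sum>k=1..K. (\<Sum>j=1..N. real (B\<^sub>R + b j)) / real K)"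
    by (intro has_bochner_integral_sum)
  then have "expectation (\<lambda>\<omega>. \<Sum>m=1..M\<^sub>t. \<Sum>k=1..K. real (bits m k \<omega>))
      = (\<Sum>m=1..M\<^sub>t. \<Sum>k=1..K. (\<Sum>j=1..N. real (B\<^sub>R + b j)) / real K)"
    by (rule has_bochner_integral_integral_eq)
  \<comment> \<open>The inner summand is constant in \<open>k\<close>, and
    \<open>1 \<le> N \<le> K\<close> makes \<open>K\<close> nonzero, so \<open>K\<close>
    cancels.\<close>
  also have "\<dots> = real M\<^sub>t * (\<Sum>j=1..N. real (B\<^sub>R + b j))"
    using assms(3,4) by simp
  also have "(\<Sum>j=1..N. real (B\<^sub>R + b j)) = real (N * B\<^sub>R + B\<^sub>Q)"
    by (simp add: sum.distrib flip: assms(6))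
  finally show ?thesis by simp
qed

end
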